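(* For every $n\ge 0$, $$G_{n+1}(x_1,x_2;y_1,y_2)=M_n(x_1y_1;\,x_2+y_2).$$
   Context: A plane tree is an unlabeled rooted tree in which the children of every vertex are linearly ordered from left to right; $\mathcal{P}_n$ is the set of plane trees with $n$ edges. A leaf is a vertex with no children, an interior vertex one with at least one child. A leaf is an old leaf if it is the leftmost child of its parent (including a leaf that is the only child), and a young leaf otherwise. For $T\in\mathcal P_n$, $\mathrm{oleaf}(T),\mathrm{yleaf}(T)$ are the numbers of old and young leaves, $\mathrm{oint}(T)$ the number of interior vertices that are parents of old leaves, $\mathrm{yint}(T)$ the number of interior vertices that are not parents of old leaves. For $n\ge1$, $G_n(x_1,x_2;y_1,y_2)=\sum_{T\in\mathcal P_n}x_1^{\mathrm{oleaf}(T)}x_2^{\mathrm{yleaf}(T)}y_1^{\mathrm{oint}(T)}y_2^{\mathrm{yint}(T)}$. The Motzkin polynomials are $M_n(u;v)=\sum_{k=0}^{\lfloor n/2\rfloor}\binom{n}{2k}C_k u^{k+1}v^{n-2k}$, where $C_k=\frac{1}{k+1}\binom{2k}{k}$ is the Catalan number. *)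

theory Defs
  imports Complex_Main
begin

text \<open>
  A plane tree is given by the left-to-right list of the subtrees hanging off its root.
  A vertex is addressed by the path leading to it from the root, as a list of child positions
  counted from 0; the root is the empty path, and the children of \<open>p\<close>, from left to
  right, are \<open>p @ [0]\<close>, \<open>p @ [1]\<close>, \<dots>
\<close>

datatype ptree = Node (subtrees: "ptree list")

fun is_vertex :: "ptree \<Rightarrow> nat list \<Rightarrow> bool" where
  "is_vertex T [] \<longleftrightarrow> True"
| "is_vertex T (i # p) \<longleftrightarrow> i < length (subtrees T) \<and> is_vertex (subtrees T ! i) p"

definition vertices :: "ptree \<Rightarrow> nat list set" where
  "vertices T = {p. is_vertex T p}"

definition children :: "ptree \<Rightarrow> nat list \<Rightarrow> nat list set" where
  "children T p = {q \<in> vertices T. \<exists>i. q = p @ [i]}"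

definition edges :: "ptree \<Rightarrow> (nat list \<times> nat list) set" where
  "edges T = {(p, q). p \<in> vertices T \<and> q \<in> children T p}"

definition plane_trees :: "nat \<Rightarrow> ptree set" where
  "plane_trees n = {T. card (edges T) = n}"

definition leaves :: "ptree \<Rightarrow> nat list set" where
  "leaves T = {p \<in> vertices T. children T p = {}}"

definition interior_vertices :: "ptree \<Rightarrow> nat list set" where
  "interior_vertices T = {p \<in> vertices T. children T p \<noteq> {}}"

definition old_leaves :: "ptree \<Rightarrow> nat list set" where
  "old_leaves T = {p \<in> leaves T. \<exists>q. p = q @ [0]}"

definition young_leaves :: "ptree \<Rightarrow> nat list set" where
  "young_leaves T = leaves T - old_leaves T"

definition oleaf :: "ptree \<Rightarrow> nat" where
  "oleaf T = card (old_leaves T)"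

definition yleaf :: "ptree \<Rightarrow> nat" where
  "yleaf T = card (young_leaves T)"

definition oint :: "ptree \<Rightarrow> nat" where
  "oint T = card {p \<in> interior_vertices T. children T p \<inter> old_leaves T \<noteq> {}}"

definition yint :: "ptree \<Rightarrow> nat" where
  "yint T = card {p \<in> interior_vertices T. children T p \<inter> old_leaves T = {}}"

text \<open>
  The polynomials are given by their values in an arbitrary commutative semiring; taking a
  polynomial semiring and its indeterminates as arguments recovers the formal polynomials.
\<close>

definition G :: "nat \<Rightarrow> 'a::comm_semiring_1 \<Rightarrow> 'a \<Rightarrow> 'a \<Rightarrow> 'a \<Rightarrow> 'a" where
  "G n x1 x2 y1 y2 =
     (\<Sum>T\<in>plane_trees n. x1 ^ oleaf T * x2 ^ yleaf T * y1 ^ oint T * y2 ^ yint T)"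

text \<open>The division is exact, see \<open>real_catalan\<close> below.\<close>

definition catalan :: "nat \<Rightarrow> nat" where
  "catalan k = ((2 * k) choose k) div (k + 1)"

definition motzkin_poly :: "nat \<Rightarrow> 'a::comm_semiring_1 \<Rightarrow> 'a \<Rightarrow> 'a" where
  "motzkin_poly n u v =
     (\<Sum>k = 0..n div 2. of_nat (n choose (2 * k)) * of_nat (catalan k) * u ^ (k + 1) * v ^ (n - 2 * k))"

lemma real_catalan: "real (catalan k) = 1 / (real k + 1) * real ((2 * k) choose k)"
proof -
  let ?B = "(2 * k) choose k" and ?B' = "(2 * k) choose (Suc k)"
  have "Suc k * ?B' = k * ?B"
  proof -
    have "2 * k - k = k" by simp
    then show ?thesis
      using binomial_absorb_comp[of "2 * k" k] binomial_absorption[of k "2 * k"] by metis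
  qed
  then have "(k + 1) * (?B - ?B') = ?B"
    by (simp add: diff_mult_distrib2)
  then have "(k + 1) dvd ?B"
    by (metis dvd_triv_left)
  then show ?thesis
    by (simp add: catalan_def real_of_nat_div)
qed

text \<open>
  The sum defining \<open>G\<close> and the cardinalities above range over finite sets
  (Isabelle sets both to 0 on infinite sets).
\<close>

lemma vertices_Node:
  "vertices (Node ts) = insert [] (\<Union>i<length ts. (#) i ` vertices (ts ! i))"
proof (rule set_eqI)
  fix p
  show "p \<in> vertices (Node ts) \<longleftrightarrow> p \<in> insert [] (\<Union>i<length ts. (#) i ` vertices (ts ! i))"
    by (cases p) (auto simp: vertices_def)
qed

lemma finite_vertices: "finite (vertices T)"
  by (induction T) (auto simp: vertices_Node)

lemma card_vertices_Node:
  "card (vertices (Node ts)) = Suc (\<Sum>i<length ts. card (vertices (ts ! i)))"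
proof -
  have "card (\<Union>i<length ts. (#) i ` vertices (ts ! i))
      = (\<Sum>i<length ts. card ((#) i ` vertices (ts ! i)))"
    by (intro card_UN_disjoint) (auto simp: finite_vertices)
  also have "\<dots> = (\<Sum>i<length ts. card (vertices (ts ! i)))"
    by (simp add: card_image)
  finally show ?thesis
    by (subst vertices_Node, subst card_insert_disjoint) (auto simp: finite_vertices)
qed

lemma vertices_prefix: "p @ q \<in> vertices T \<Longrightarrow> p \<in> vertices T"
  unfolding vertices_def mem_Collect_eq
  by (induction T p rule: is_vertex.induct) auto

lemma card_vertices: "card (vertices T) = Suc (card (edges T))"
proof -
  have "snd ` edges T = vertices T - {[]}"
  proof
    show "vertices T - {[]} \<subseteq> snd ` edges T"
    proof
      fix p assume p: "p \<in> vertices T - {[]}"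
      then have "(butlast p, p) \<in> edges T"
        unfolding edges_def children_def
        using vertices_prefix[of "butlast p" "[last p]" T]
        by (auto intro!: exI[of _ "last p"])
      then show "p \<in> snd ` edges T" by force
    qed
  qed (auto simp: edges_def children_def)
  moreover have "inj_on snd (edges T)"
    by (auto simp: inj_on_def edges_def children_def)
  ultimately have "card (edges T) = card (vertices T - {[]})"
    by (metis card_image)
  moreover have "[] \<in> vertices T"
    by (simp add: vertices_def)
  ultimately show ?thesis
    by (metis card_Suc_Diff1 finite_vertices)
qed

lemma finite_plane_trees: "finite (plane_trees n)"
proof -
  have "finite {T. card (vertices T) \<le> m}" for m
  proof (induction m)
    case 0
    then show ?case by (simp add: card_vertices)
  next
    case (Suc m)
    let ?S = "{T. card (vertices T) \<le> m}"
    have "{T. card (vertices T) \<le> Suc m} \<subseteq> Node ` {ts. set ts \<subseteq> ?S \<and> length ts \<le> m}"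
    proof
      fix T assume "T \<in> {T. card (vertices T) \<le> Suc m}"
      moreover obtain ts where T: "T = Node ts" by (cases T)
      ultimately have le: "(\<Sum>i<length ts. card (vertices (ts ! i))) \<le> m"
        by (simp add: card_vertices_Node)
      have "(\<Sum>i<length ts. 1) \<le> (\<Sum>i<length ts. card (vertices (ts ! i)))"
        by (intro sum_mono) (simp add: card_vertices)
      with le have "length ts \<le> m" by simp
      moreover have "card (vertices (ts ! i)) \<le> m" if "i < length ts" for i
        using member_le_sum[of i "{..<length ts}" "\<lambda>i. card (vertices (ts ! i))"] that le
        by simp
      then have "set ts \<subseteq> ?S" by (auto simp: in_set_conv_nth)
      ultimately show "T \<in> Node ` {ts. set ts \<subseteq> ?S \<and> length ts \<le> m}"
        using T by blast
    qed
    then show ?case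
      by (rule finite_subset) (intro finite_imageI finite_lists_length_le Suc)
  qed
  from this[of "Suc n"] show ?thesis
    by (rule rev_finite_subset) (auto simp: plane_trees_def card_vertices)
qed

end

theory Submission
  imports Defs
begin

text \<open>
  Split a tree with at least one edge into its rightmost principal subtree and the rest. With the
  single vertex weighted by \<open>x2\<close> (it counts as a young leaf) the weight is multiplicative, unless the
  rest is a single vertex; that case produces the factors \<open>x1 * y1\<close> or \<open>y2\<close>. So \<open>g n = G (n + 1)\<close>
  satisfies \<open>g 0 = x1 * y1\<close> and
  \<open>g (n + 1) = (x2 + y2) * g n + (\<Sum>i<n. g i * g (n - 1 - i))\<close>. The Motzkin polynomials
  satisfy the same recursion, because of
  \<open>(\<Sum>i\<le>n. (i choose r) * (n - i choose s)) = (n + 1) choose (r + s + 1)\<close> and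
  the Catalan convolution.
\<close>

section \<open>The Motzkin recursion\<close>

text \<open>Classify the (r + s + 1)-subsets of {0..n} by their element \<open>i\<close> that has
  \<open>r\<close> smaller and \<open>s\<close> larger ones. The formal induction uses Pascal's
  rule, with the hockey-stick identity for \<open>s = 0\<close>.\<close>

lemma sum_choose_mult_choose:
  "(\<Sum>i\<le>n. (i choose r) * ((n - i) choose s)) = Suc n choose Suc (r + s)"
proof (induction n arbitrary: s)
  case 0
  then show ?case by (cases r; cases s) auto
next
  case (Suc n)
  show ?case
  proof (cases s)
    case 0
    then show ?thesis
      using sum_choose_upper[of r "Suc n"] by (simp add: atMost_atLeast0 del: binomial_Suc_Suc)
  next
    case (Suc s')
    \<comment> \<open>The summand \<open>i = Suc n\<close> vanishes because \<open>s\<close> is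
      positive; Pascal's rule splits the others.\<close>
    have "(\<Sum>i\<le>Suc n. (i choose r) * ((Suc n - i) choose s))
        = (\<Sum>i\<le>n. (i choose r) * ((n - i) choose s') + (i choose r) * ((n - i) choose s))"
      by (simp add: Suc Suc_diff_le distrib_left)
    also have "\<dots> = (Suc n choose Suc (r + s')) + (Suc n choose Suc (r + s))"
      by (simp only: sum.distrib Suc.IH)
    finally show ?thesis by (simp add: Suc)
  qed
qed

section \<open>Catalan numbers: two-term recursion and convolution\<close>

lemma catalan_Suc: "(k + 2) * catalan (Suc k) = (4 * k + 2) * catalan k"
proof -
  have fact: "real (2 * m choose m) = fact (2 * m) / (fact m * fact m)" for m
    using binomial_fact[of m "2 * m", where ?'a = real] by (simp add: mult_2)
  \<comment> \<open>Over the reals the division in \<open>catalan\<close> is an exact quotient of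
    factorials.\<close>
  have "(real k + 2) * real (catalan (Suc k)) = (4 * real k + 2) * real (catalan k)"
    unfolding real_catalan fact by (simp add: divide_simps) (simp add: algebra_simps)
  then have "real ((k + 2) * catalan (Suc k)) = real ((4 * k + 2) * catalan k)"
    by (simp only: of_nat_add of_nat_mult of_nat_numeral)
  then show ?thesis by (simp only: of_nat_eq_iff)
qed

text \<open>The reflection of \<open>i\<close> to \<open>n - i\<close> fixes each product of Catalan
  numbers; doubling avoids halves.\<close>

lemma sum_mult_catalan_conv:
  "2 * (\<Sum>i\<le>n. i * (catalan i * catalan (n - i))) = n * (\<Sum>i\<le>n. catalan i * catalan (n - i))"
proof -
  let ?c = "\<lambda>i. catalan i * catalan (n - i)"
  have "(\<Sum>i\<le>n. i * ?c i) = (\<Sum>i\<le>n. (n - i) * ?c (n - i))"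
    by (rule sum.reindex_bij_witness[of _ "\<lambda>i. n - i" "\<lambda>i. n - i"]) auto
  also have "\<dots> = (\<Sum>i\<le>n. (n - i) * ?c i)"
    by (intro sum.cong) auto
  finally have "2 * (\<Sum>i\<le>n. i * ?c i) = (\<Sum>i\<le>n. i * ?c i + (n - i) * ?c i)"
    by (simp add: sum.distrib)
  also have "\<dots> = (\<Sum>i\<le>n. n * ?c i)"
    by (intro sum.cong) (auto simp flip: distrib_right)
  finally show ?thesis by (simp add: sum_distrib_left)
qed

lemma catalan_0: "catalan 0 = 1"
  by (simp add: catalan_def)

text \<open>
  By symmetry a factor \<open>i\<close> in the convolution sum \<open>D n\<close> averages to \<open>n / 2\<close>. Hence the two-term
  recursion of the Catalan numbers gives \<open>(n + 3) * D (n + 1) = (4 * n + 4) * D n + 2 * catalan (n + 1)\<close>.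
\<close>

lemma catalan_conv: "(\<Sum>i\<le>n. catalan i * catalan (n - i)) = catalan (Suc n)"
proof (induction n)
  case 0
  then show ?case using catalan_Suc[of 0] by (simp add: catalan_0)
next
  case (Suc n)
  define D where "D m = (\<Sum>i\<le>m. catalan i * catalan (m - i))" for m
  \<comment> \<open>With the factor \<open>i + 1\<close>, shifting the index produces the left side
    of \<open>catalan_Suc\<close>.\<close>
  have "(\<Sum>i\<le>Suc n. (i + 1) * (catalan i * catalan (Suc n - i)))
      = catalan (Suc n) + (\<Sum>i\<le>n. (i + 2) * catalan (Suc i) * catalan (n - i))"
    by (subst sum.atMost_Suc_shift) (simp add: catalan_0 algebra_simps)
  also have "\<dots> = catalan (Suc n) + (\<Sum>i\<le>n. (4 * i + 2) * catalan i * catalan (n - i))"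
    by (simp only: catalan_Suc)
  also have "\<dots> = catalan (Suc n) + 2 * (2 * (\<Sum>i\<le>n. i * (catalan i * catalan (n - i)))) + 2 * D n"
    by (simp add: D_def sum_distrib_left sum.distrib algebra_simps)
  also have "\<dots> = catalan (Suc n) + (2 * n + 2) * D n"
    unfolding sum_mult_catalan_conv D_def[symmetric] by (simp add: algebra_simps)
  finally have A: "(\<Sum>i\<le>Suc n. (i + 1) * (catalan i * catalan (Suc n - i)))
      = catalan (Suc n) + (2 * n + 2) * D n" .
  \<comment> \<open>The same sum is evaluated a second time, now by symmetry.\<close>
  have "2 * (\<Sum>i\<le>Suc n. (i + 1) * (catalan i * catalan (Suc n - i)))
      = 2 * (\<Sum>i\<le>Suc n. i * (catalan i * catalan (Suc n - i))) + 2 * D (Suc n)"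
    by (simp only: D_def distrib_right sum.distrib distrib_left mult_1)
  also have "\<dots> = (n + 3) * D (Suc n)"
    unfolding sum_mult_catalan_conv D_def[symmetric] by (simp add: algebra_simps)
  finally have "(n + 3) * D (Suc n) = 2 * catalan (Suc n) + (4 * n + 4) * D n"
    unfolding A by (simp add: algebra_simps)
  also have "D n = catalan (Suc n)" using Suc by (simp add: D_def)
  also have "2 * catalan (Suc n) + (4 * n + 4) * catalan (Suc n) = (n + 3) * catalan (Suc (Suc n))"
    using catalan_Suc[of "Suc n"] by (simp add: algebra_simps)
  finally show ?case unfolding D_def by (simp del: sum.atMost_Suc)
qed

section \<open>Recursion for the Motzkin polynomials\<close>

text \<open>The added binomials are zero. A common bound for all degrees allows sums to be
  interchanged.\<close>

lemma motzkin_poly_eq_sum: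
  assumes "n div 2 \<le> N"
  shows "motzkin_poly n u v =
    (\<Sum>k\<le>N. of_nat (n choose (2 * k)) * of_nat (catalan k) * u ^ (k + 1) * v ^ (n - 2 * k))"
  unfolding motzkin_poly_def using assms
  by (intro sum.mono_neutral_left) (auto simp: not_le binomial_eq_0)

lemma motzkin_poly_0: "motzkin_poly 0 u v = u"
  by (simp add: motzkin_poly_def catalan_0)

lemma motzkin_poly_1: "motzkin_poly (Suc 0) u v = v * u"
  by (simp add: motzkin_poly_def catalan_0 mult.commute)

text \<open>Summing over \<open>i\<close> first merges the two binomials into one that depends only
  on \<open>k = a + b\<close>; what remains on each diagonal is a Catalan convolution.\<close>

lemma sum_motzkin_poly_mult:
  fixes u v :: "'a::comm_semiring_1"
  shows "(\<Sum>i\<le>n. motzkin_poly i u v * motzkin_poly (n - i) u v) =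
    (\<Sum>k\<le>n. of_nat (Suc n choose Suc (2 * k)) * of_nat (catalan (Suc k)) * u ^ (k + 2) * v ^ (n - 2 * k))"
    (is "?L = (\<Sum>k\<le>n. ?r k)")
proof -
  let ?t = "\<lambda>a b. of_nat (Suc n choose Suc (2 * (a + b))) * of_nat (catalan a * catalan b)
      * u ^ (a + b + 2) * v ^ (n - 2 * (a + b)) :: 'a"
  let ?m = "\<lambda>i a. of_nat (i choose (2 * a)) * of_nat (catalan a) * u ^ (a + 1) * v ^ (i - 2 * a) :: 'a"
  have "?L = (\<Sum>i\<le>n. (\<Sum>a\<le>n. ?m i a) * (\<Sum>b\<le>n. ?m (n - i) b))"
    by (intro sum.cong refl arg_cong2[where f = "(*)"] motzkin_poly_eq_sum) auto
  also have "\<dots> = (\<Sum>i\<le>n. \<Sum>a\<le>n. \<Sum>b\<le>n. ?m i a * ?m (n - i) b)"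
    by (simp only: sum_product)
  also have "\<dots> = (\<Sum>a\<le>n. \<Sum>i\<le>n. \<Sum>b\<le>n. ?m i a * ?m (n - i) b)"
    by (rule sum.swap)
  also have "\<dots> = (\<Sum>a\<le>n. \<Sum>b\<le>n. \<Sum>i\<le>n. ?m i a * ?m (n - i) b)"
    by (intro sum.cong refl sum.swap)
  also have "\<dots> = (\<Sum>a\<le>n. \<Sum>b\<le>n. ?t a b)"
  proof (intro sum.cong refl)
    fix a b
    have "?m i a * ?m (n - i) b = of_nat ((i choose (2 * a)) * ((n - i) choose (2 * b)))
        * (of_nat (catalan a * catalan b) * u ^ (a + b + 2) * v ^ (n - 2 * (a + b)))"
      if "i \<le> n" for i
    \<comment> \<open>The truncated exponents add up only if both differences are genuine; otherwise
      a binomial is 0.\<close>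
    proof (cases "2 * a \<le> i \<and> 2 * b \<le> n - i")
      case True
      with that have "n - 2 * (a + b) = (i - 2 * a) + (n - i - 2 * b)" by auto
      then show ?thesis by (simp add: power_add mult_ac)
    next
      case False
      then show ?thesis by (auto simp: not_le binomial_eq_0)
    qed
    then have "(\<Sum>i\<le>n. ?m i a * ?m (n - i) b)
        = of_nat (\<Sum>i\<le>n. (i choose (2 * a)) * ((n - i) choose (2 * b)))
          * (of_nat (catalan a * catalan b) * u ^ (a + b + 2) * v ^ (n - 2 * (a + b)))"
      by (simp add: sum_distrib_right)
    then show "(\<Sum>i\<le>n. ?m i a * ?m (n - i) b) = ?t a b"
      by (simp only: sum_choose_mult_choose) (simp add: mult.assoc)
  qed
  also have "\<dots> = (\<Sum>(a, b)\<in>{..n} \<times> {..n}. ?t a b)"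
    by (simp add: sum.cartesian_product)
  also have "\<dots> = (\<Sum>(a, b)\<in>{(a, b). a + b \<le> n}. ?t a b)"
  proof (rule sum.mono_neutral_right)
    have "?t a b = 0" if "n < a + b" for a b
      using that by (simp add: binomial_eq_0 del: binomial_Suc_Suc)
    then show "\<forall>p\<in>{..n} \<times> {..n} - {(a, b). a + b \<le> n}. (case p of (a, b) \<Rightarrow> ?t a b) = 0"
      by (simp add: not_le split_beta del: binomial_Suc_Suc)
  qed auto
  also have "\<dots> = (\<Sum>k\<le>n. \<Sum>a\<le>k. ?t a (k - a))"
    by (rule sum.triangle_reindex_eq)
  also have "\<dots> = (\<Sum>k\<le>n. ?r k)"
  proof (intro sum.cong refl)
    fix k
    have "(\<Sum>a\<le>k. ?t a (k - a)) = (\<Sum>a\<le>k. of_nat (Suc n choose Suc (2 * k))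
        * of_nat (catalan a * catalan (k - a)) * (u ^ (k + 2) * v ^ (n - 2 * k)))"
      by (intro sum.cong) (auto simp: mult.assoc)
    also have "\<dots> = of_nat (Suc n choose Suc (2 * k))
        * of_nat (\<Sum>a\<le>k. catalan a * catalan (k - a)) * (u ^ (k + 2) * v ^ (n - 2 * k))"
      by (simp only: sum_distrib_left sum_distrib_right of_nat_sum)
    finally show "(\<Sum>a\<le>k. ?t a (k - a)) = ?r k"
      by (simp only: catalan_conv mult.assoc)
  qed
  finally show ?thesis .
qed

text \<open>Pascal's rule splits the coefficient: even lower indices give the multiple of
  \<open>v\<close>, odd ones the convolution.\<close>

lemma motzkin_poly_Suc_Suc:
  fixes u v :: "'a::comm_semiring_1"
  shows "motzkin_poly (Suc (Suc n)) u v =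
    v * motzkin_poly (Suc n) u v + (\<Sum>i\<le>n. motzkin_poly i u v * motzkin_poly (n - i) u v)"
proof -
  let ?f = "\<lambda>c p k. of_nat c * of_nat (catalan k) * u ^ (k + 1) * v ^ p :: 'a"
  have shift: "v * ?f (Suc n choose (2 * k)) (Suc n - 2 * k) k
      = ?f (Suc n choose (2 * k)) (Suc (Suc n) - 2 * k) k" for k
  proof (cases "2 * k \<le> Suc n")
    case True
    then show ?thesis by (simp add: Suc_diff_le mult_ac)
  next
    case False
    then show ?thesis by (simp add: binomial_eq_0)
  qed
  have "motzkin_poly (Suc (Suc n)) u v
      = (\<Sum>k\<le>Suc n. ?f (Suc (Suc n) choose (2 * k)) (Suc (Suc n) - 2 * k) k)"
    by (rule motzkin_poly_eq_sum) simp
  \<comment> \<open>The term \<open>k = 0\<close> is set aside, since Pascal's rule needs a positive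
    lower index; it later rejoins the even part.\<close>
  also have "\<dots> = ?f 1 (Suc (Suc n)) 0
      + (\<Sum>k\<le>n. ?f (Suc (Suc n) choose (2 * Suc k)) (Suc (Suc n) - 2 * Suc k) (Suc k))"
    by (subst sum.atMost_Suc_shift) simp
  also have "(\<Sum>k\<le>n. ?f (Suc (Suc n) choose (2 * Suc k)) (Suc (Suc n) - 2 * Suc k) (Suc k))
      = (\<Sum>k\<le>n. ?f (Suc n choose (2 * Suc k)) (Suc (Suc n) - 2 * Suc k) (Suc k))
        + (\<Sum>k\<le>n. ?f (Suc n choose Suc (2 * k)) (n - 2 * k) (Suc k))"
    unfolding sum.distrib[symmetric]
    by (intro sum.cong refl) (simp add: distrib_right add_ac)
  also have "?f 1 (Suc (Suc n)) 0 + (\<dots>) =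
      (\<Sum>k\<le>Suc n. ?f (Suc n choose (2 * k)) (Suc (Suc n) - 2 * k) k)
        + (\<Sum>k\<le>n. ?f (Suc n choose Suc (2 * k)) (n - 2 * k) (Suc k))"
    by (subst sum.atMost_Suc_shift) (simp add: add.assoc)
  also have "(\<Sum>k\<le>n. ?f (Suc n choose Suc (2 * k)) (n - 2 * k) (Suc k))
      = (\<Sum>i\<le>n. motzkin_poly i u v * motzkin_poly (n - i) u v)"
    unfolding sum_motzkin_poly_mult by (simp del: binomial_Suc_Suc)
  also have "(\<Sum>k\<le>Suc n. ?f (Suc n choose (2 * k)) (Suc (Suc n) - 2 * k) k)
      = v * motzkin_poly (Suc n) u v"
    unfolding shift[symmetric] sum_distrib_left[symmetric]
    by (rule arg_cong[where f = "(*) v"], rule motzkin_poly_eq_sum[symmetric]) simp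
  finally show ?thesis .
qed

section \<open>The tree recursion\<close>

lemma Nil_in_vertices [simp]: "[] \<in> vertices T"
  by (simp add: vertices_def)

lemma Cons_in_vertices [simp]:
  "i # p \<in> vertices (Node ts) \<longleftrightarrow> i < length ts \<and> p \<in> vertices (ts ! i)"
  by (simp add: vertices_def)

lemma mem_children: "q \<in> children T p \<longleftrightarrow> q \<in> vertices T \<and> (\<exists>i. q = p @ [i])"
  by (simp add: children_def)

lemma children_Nil: "children (Node ts) [] = (\<lambda>i. [i]) ` {..<length ts}"
  by (auto simp: children_def)

lemma children_Cons:
  "children (Node ts) (i # p) = (if i < length ts then (#) i ` children (ts ! i) p else {})"
  by (auto simp: children_def)

lemma Nil_in_leaves [simp]: "[] \<in> leaves T \<longleftrightarrow> T = Node []"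
  by (cases T) (auto simp: leaves_def children_Nil)

lemma Cons_in_leaves [simp]:
  "i # p \<in> leaves (Node ts) \<longleftrightarrow> i < length ts \<and> p \<in> leaves (ts ! i)"
  by (auto simp: leaves_def children_Cons)

lemma Nil_notin_old_leaves [simp]: "[] \<notin> old_leaves T"
  by (simp add: old_leaves_def)

text \<open>Being old depends on the last entry of the path, which survives removal of the first
  entry unless the path has length one.\<close>

lemma Cons_in_old_leaves:
  "i # p \<in> old_leaves (Node ts) \<longleftrightarrow>
    i < length ts \<and> (if p = [] then i = 0 \<and> ts ! i = Node [] else p \<in> old_leaves (ts ! i))"
  by (cases p rule: rev_cases) (auto simp: old_leaves_def Cons_eq_append_conv)

lemma Nil_in_young_leaves [simp]: "[] \<in> young_leaves T \<longleftrightarrow> T = Node []"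
  by (simp add: young_leaves_def)

lemma Cons_in_young_leaves:
  "i # p \<in> young_leaves (Node ts) \<longleftrightarrow>
    i < length ts \<and> (if p = [] then i \<noteq> 0 \<and> ts ! i = Node [] else p \<in> young_leaves (ts ! i))"
  by (auto simp: young_leaves_def Cons_in_old_leaves)

definition old_parents :: "ptree \<Rightarrow> nat list set" where
  "old_parents T = {p \<in> interior_vertices T. children T p \<inter> old_leaves T \<noteq> {}}"

definition other_parents :: "ptree \<Rightarrow> nat list set" where
  "other_parents T = {p \<in> interior_vertices T. children T p \<inter> old_leaves T = {}}"

text \<open>A child inside the subtree has a nonempty path there, so the exceptional case of
  \<open>Cons_in_old_leaves\<close> cannot occur.\<close>

lemma children_Cons_old_leaves:
  "i < length ts \<Longrightarrow>
    children (Node ts) (i # p) \<inter> old_leaves (Node ts) = (#) i ` (children (ts ! i) p \<inter> old_leaves (ts ! i))"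
  by (auto simp: children_Cons Cons_in_old_leaves mem_children)

lemma children_Nil_old_leaves:
  "children (Node ts) [] \<inter> old_leaves (Node ts) = (if ts \<noteq> [] \<and> ts ! 0 = Node [] then {[0]} else {})"
  by (auto simp: children_Nil Cons_in_old_leaves)

lemma children_Nil_eq_empty: "children (Node ts) [] = {} \<longleftrightarrow> ts = []"
  by (auto simp: children_Nil)

lemma children_Cons_eq_empty:
  "i < length ts \<Longrightarrow> children (Node ts) (i # p) = {} \<longleftrightarrow> children (ts ! i) p = {}"
  by (simp add: children_Cons)

lemma Nil_in_old_parents:
  "[] \<in> old_parents (Node ts) \<longleftrightarrow> ts \<noteq> [] \<and> ts ! 0 = Node []"
  by (auto simp: old_parents_def interior_vertices_def children_Nil_eq_empty children_Nil_old_leaves)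

lemma Nil_in_other_parents:
  "[] \<in> other_parents (Node ts) \<longleftrightarrow> ts \<noteq> [] \<and> ts ! 0 \<noteq> Node []"
  by (auto simp: other_parents_def interior_vertices_def children_Nil_eq_empty children_Nil_old_leaves)

text \<open>This property looks only at children, so the root of a subtree needs no
  exception.\<close>

lemma Cons_in_old_parents:
  "i # p \<in> old_parents (Node ts) \<longleftrightarrow> i < length ts \<and> p \<in> old_parents (ts ! i)"
  by (cases "i < length ts")
     (simp_all add: old_parents_def interior_vertices_def children_Cons_old_leaves
       children_Cons_eq_empty)

lemma Cons_in_other_parents:
  "i # p \<in> other_parents (Node ts) \<longleftrightarrow> i < length ts \<and> p \<in> other_parents (ts ! i)"
  by (cases "i < length ts")
     (simp_all add: other_parents_def interior_vertices_def children_Cons_old_leaves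
       children_Cons_eq_empty)

section \<open>Weights of trees and their behaviour under grafting\<close>

definition weight :: "'a::comm_semiring_1 \<Rightarrow> 'a \<Rightarrow> 'a \<Rightarrow> 'a \<Rightarrow> ptree \<Rightarrow> 'a" where
  "weight x1 x2 y1 y2 T = x1 ^ card (old_leaves T) * x2 ^ card (young_leaves T)
     * y1 ^ card (old_parents T) * y2 ^ card (other_parents T)"

lemma G_eq_sum_weight: "G n x1 x2 y1 y2 = sum (weight x1 x2 y1 y2) (plane_trees n)"
  by (simp add: G_def weight_def[abs_def] oleaf_def yleaf_def oint_def yint_def
      old_parents_def other_parents_def)

lemma finite_vertex_sets:
  "finite (old_leaves T)" "finite (young_leaves T)" "finite (old_parents T)" "finite (other_parents T)"
  by (rule finite_subset[OF _ finite_vertices[of T]];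
      auto simp: old_leaves_def young_leaves_def leaves_def old_parents_def other_parents_def
        interior_vertices_def)+

lemma set_eqI_Cons:
  assumes "[] \<in> A \<longleftrightarrow> [] \<in> B" and "\<And>i p. i # p \<in> A \<longleftrightarrow> i # p \<in> B"
  shows "A = B"
proof (rule set_eqI)
  fix p show "p \<in> A \<longleftrightarrow> p \<in> B" using assms by (cases p) auto
qed

text \<open>Appending on the right preserves the positions of the existing children, so paths of
  \<open>T\<close> keep their addresses.\<close>

definition graft :: "ptree \<Rightarrow> ptree \<Rightarrow> ptree" where
  "graft T t = Node (subtrees T @ [t])"

lemma graft_eq_iff: "graft T t = graft T' t' \<longleftrightarrow> T = T' \<and> t = t'"
  by (auto simp: graft_def ptree.expand)

lemma vertex_sets_Node_Nil:
  "old_leaves (Node []) = {}" "young_leaves (Node []) = {[]}"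
  "old_parents (Node []) = {}" "other_parents (Node []) = {}"
  by (rule set_eqI_Cons;
      simp add: Cons_in_old_leaves Cons_in_young_leaves Nil_in_old_parents Nil_in_other_parents
        Cons_in_old_parents Cons_in_other_parents)+

lemma weight_Node_Nil: "weight x1 x2 y1 y2 (Node []) = x2"
  by (simp add: weight_def vertex_sets_Node_Nil)

text \<open>The root of \<open>t\<close> is not a leftmost child, so it is a young leaf if
  \<open>t\<close> is a single vertex, as it was in \<open>t\<close> alone. The root of
  \<open>T\<close> keeps its leftmost subtree and hence its kind.\<close>

lemma weight_graft:
  assumes "T \<noteq> Node []"
  shows "weight x1 x2 y1 y2 (graft T t) = weight x1 x2 y1 y2 T * weight x1 x2 y1 y2 t"
proof -
  obtain ts where T: "T = Node ts" "ts \<noteq> []" using assms by (cases T) auto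
  let ?n = "length ts"
  have eqs: "old_leaves (graft T t) = old_leaves T \<union> (#) ?n ` old_leaves t"
    "young_leaves (graft T t) = young_leaves T \<union> (#) ?n ` young_leaves t"
    "old_parents (graft T t) = old_parents T \<union> (#) ?n ` old_parents t"
    "other_parents (graft T t) = other_parents T \<union> (#) ?n ` other_parents t"
    by (rule set_eqI_Cons; use T in \<open>auto simp: graft_def nth_append less_Suc_eq
        Cons_in_old_leaves Cons_in_young_leaves Nil_in_old_parents Nil_in_other_parents
        Cons_in_old_parents Cons_in_other_parents\<close>)+
  have card: "card (A \<union> (#) ?n ` B) = card A + card B"
    if "finite A" "finite B" "A \<subseteq> vertices T" for A B
  proof -
    \<comment> \<open>Nonempty paths of \<open>T\<close> start with an index below
      \<open>?n\<close>.\<close>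
    have "A \<inter> (#) ?n ` B = {}" using that T by auto
    with that show ?thesis by (simp add: card_Un_disjoint card_image)
  qed
  have "old_leaves T \<subseteq> vertices T" "young_leaves T \<subseteq> vertices T"
    "old_parents T \<subseteq> vertices T" "other_parents T \<subseteq> vertices T"
    by (auto simp: old_leaves_def young_leaves_def leaves_def old_parents_def other_parents_def
        interior_vertices_def)
  then show ?thesis
    unfolding weight_def eqs by (simp add: card finite_vertex_sets power_add mult_ac)
qed

lemma weight_graft_Nil_Nil: "weight x1 x2 y1 y2 (graft (Node []) (Node [])) = x1 * y1"
proof -
  have "old_leaves (graft (Node []) (Node [])) = {[0]}" "young_leaves (graft (Node []) (Node [])) = {}"
    "old_parents (graft (Node []) (Node [])) = {[]}" "other_parents (graft (Node []) (Node [])) = {}"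
    by (rule set_eqI_Cons;
        auto simp: graft_def vertex_sets_Node_Nil Cons_in_old_leaves Cons_in_young_leaves Nil_in_old_parents
          Nil_in_other_parents Cons_in_old_parents Cons_in_other_parents)+
  then show ?thesis by (simp add: weight_def)
qed

text \<open>The root turns from a young leaf into an interior vertex whose leftmost child is no
  leaf, so \<open>y2\<close> stands in place of \<open>x2\<close>.\<close>

lemma weight_graft_Nil:
  assumes "t \<noteq> Node []"
  shows "weight x1 x2 y1 y2 (graft (Node []) t) = y2 * weight x1 x2 y1 y2 t"
proof -
  have "old_leaves (graft (Node []) t) = (#) 0 ` old_leaves t"
    "young_leaves (graft (Node []) t) = (#) 0 ` young_leaves t"
    "old_parents (graft (Node []) t) = (#) 0 ` old_parents t"
    "other_parents (graft (Node []) t) = insert [] ((#) 0 ` other_parents t)"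
    by (rule set_eqI_Cons; use assms in \<open>auto simp: graft_def
          Cons_in_old_leaves Cons_in_young_leaves Nil_in_old_parents
          Nil_in_other_parents Cons_in_old_parents Cons_in_other_parents\<close>)+
  moreover have "[] \<notin> (#) 0 ` other_parents t" by auto
  ultimately show ?thesis
    by (simp add: weight_def card_image finite_vertex_sets mult_ac)
qed

section \<open>Decomposition of the set of plane trees\<close>

text \<open>Vertex counts simply add; each tree has one edge fewer than vertices.\<close>

lemma card_edges_graft: "card (edges (graft T t)) = Suc (card (edges T) + card (edges t))"
proof -
  obtain ts where T: "T = Node ts" by (cases T)
  have "card (vertices (graft T t)) = card (vertices T) + card (vertices t)"
    by (simp add: graft_def T card_vertices_Node nth_append)
  then show ?thesis by (simp add: card_vertices)
qed

lemma card_edges_eq_0_iff: "card (edges T) = 0 \<longleftrightarrow> T = Node []"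
proof (cases T)
  case (Node ts)
  have "card (edges (Node ts)) = (\<Sum>i<length ts. card (vertices (ts ! i)))"
    using card_vertices_Node[of ts] by (simp add: card_vertices)
  then show ?thesis using Node by (auto simp: card_vertices)
qed

lemma plane_trees_0: "plane_trees 0 = {Node []}"
  by (simp add: plane_trees_def card_edges_eq_0_iff)

lemma Nil_in_plane_trees: "Node [] \<in> plane_trees n \<longleftrightarrow> n = 0"
  using card_edges_eq_0_iff[of "Node []"] by (auto simp: plane_trees_def)

lemma plane_trees_Suc:
  "plane_trees (Suc n) = (\<Union>i\<le>n. case_prod graft ` (plane_trees i \<times> plane_trees (n - i)))"
proof
  show "plane_trees (Suc n) \<subseteq> (\<Union>i\<le>n. case_prod graft ` (plane_trees i \<times> plane_trees (n - i)))"
  proof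
    fix T assume T: "T \<in> plane_trees (Suc n)"
    then have "T \<noteq> Node []" using Nil_in_plane_trees by auto
    then obtain us where us: "T = Node us" "us \<noteq> []" by (cases T) auto
    \<comment> \<open>The rightmost principal subtree is cut off.\<close>
    then have eq: "T = graft (Node (butlast us)) (last us)"
      by (simp add: graft_def)
    then have "card (edges (Node (butlast us))) + card (edges (last us)) = n"
      using T by (simp add: plane_trees_def card_edges_graft)
    then have "card (edges (Node (butlast us))) \<le> n"
      "Node (butlast us) \<in> plane_trees (card (edges (Node (butlast us))))"
      "last us \<in> plane_trees (n - card (edges (Node (butlast us))))"
      by (auto simp: plane_trees_def)
    then show "T \<in> (\<Union>i\<le>n. case_prod graft ` (plane_trees i \<times> plane_trees (n - i)))"
      using eq by blast
  qed
qed (auto simp: plane_trees_def card_edges_graft)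

lemma sum_plane_trees_Suc:
  "sum f (plane_trees (Suc n)) = (\<Sum>i\<le>n. \<Sum>T\<in>plane_trees i. \<Sum>t\<in>plane_trees (n - i). f (graft T t))"
proof -
  have "sum f (plane_trees (Suc n)) = (\<Sum>i\<le>n. sum f (case_prod graft ` (plane_trees i \<times> plane_trees (n - i))))"
    unfolding plane_trees_Suc
    \<comment> \<open>Disjointness: a grafted tree determines its left part, hence the edge number
      \<open>i\<close> of that part.\<close>
    by (rule sum.UNION_disjoint) (auto simp: finite_plane_trees graft_eq_iff, auto simp: plane_trees_def)
  also have "\<dots> = (\<Sum>i\<le>n. \<Sum>(T, t)\<in>plane_trees i \<times> plane_trees (n - i). f (graft T t))"
    by (intro sum.cong refl, subst sum.reindex)
       (auto simp: inj_on_def graft_eq_iff intro!: sum.cong)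
  finally show ?thesis by (simp add: sum.cartesian_product)
qed

section \<open>Recursion for \<open>G\<close>\<close>

lemma G_0: "G 0 x1 x2 y1 y2 = x2"
  by (simp add: G_eq_sum_weight plane_trees_0 weight_Node_Nil)

lemma G_1: "G (Suc 0) x1 x2 y1 y2 = x1 * y1"
  by (simp add: G_eq_sum_weight sum_plane_trees_Suc plane_trees_0 weight_graft_Nil_Nil)

lemma G_Suc_Suc:
  "G (Suc (Suc n)) x1 x2 y1 y2 = y2 * G (Suc n) x1 x2 y1 y2
    + (\<Sum>i\<le>n. G (Suc i) x1 x2 y1 y2 * G (n - i) x1 x2 y1 y2)"
proof -
  let ?w = "weight x1 x2 y1 y2"
  \<comment> \<open>The index 0, where the left part is a single vertex, is separated: only there
    multiplicativity fails.\<close>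
  have "G (Suc (Suc n)) x1 x2 y1 y2 = (\<Sum>t\<in>plane_trees (Suc n). ?w (graft (Node []) t))
    + (\<Sum>i\<le>n. \<Sum>T\<in>plane_trees (Suc i). \<Sum>t\<in>plane_trees (n - i). ?w (graft T t))"
    by (simp add: G_eq_sum_weight sum_plane_trees_Suc[of _ "Suc n"] sum.atMost_Suc_shift plane_trees_0
        del: sum.atMost_Suc)
  also have "(\<Sum>t\<in>plane_trees (Suc n). ?w (graft (Node []) t)) = (\<Sum>t\<in>plane_trees (Suc n). y2 * ?w t)"
    by (intro sum.cong refl weight_graft_Nil) (auto simp: Nil_in_plane_trees)
  also have "(\<Sum>i\<le>n. \<Sum>T\<in>plane_trees (Suc i). \<Sum>t\<in>plane_trees (n - i). ?w (graft T t))
      = (\<Sum>i\<le>n. \<Sum>T\<in>plane_trees (Suc i). \<Sum>t\<in>plane_trees (n - i). ?w T * ?w t)"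
    by (intro sum.cong refl weight_graft) (auto simp: Nil_in_plane_trees)
  finally show ?thesis
    unfolding G_eq_sum_weight sum_product by (simp only: sum_distrib_left)
qed

section \<open>Comparison of the two recursions\<close>

theorem theorem1p12:
  fixes x1 x2 y1 y2 :: "'a::comm_semiring_1" and n :: nat
  shows "G (n + 1) x1 x2 y1 y2 = motzkin_poly n (x1 * y1) (x2 + y2)"
proof (induction n rule: less_induct)
  case (less n)
  let ?G = "\<lambda>n. G n x1 x2 y1 y2" and ?M = "\<lambda>n. motzkin_poly n (x1 * y1) (x2 + y2)"
  \<comment> \<open>The Motzkin recursion starts at degree 2, which leaves two base cases.\<close>
  consider "n = 0" | "n = Suc 0" | m where "n = Suc (Suc m)"
    by (metis not0_implies_Suc)
  then show ?case
  proof cases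
    case 1
    then show ?thesis by (simp add: G_1 motzkin_poly_0)
  next
    case 2
    then show ?thesis
      by (simp add: G_Suc_Suc G_0 G_1 motzkin_poly_1 distrib_left distrib_right mult_ac add_ac)
  next
    case 3
    have "?G (n + 1) = y2 * ?G (Suc m + 1) + (\<Sum>i\<le>Suc m. ?G (Suc i) * ?G (Suc m - i))"
      using G_Suc_Suc[of "Suc m" x1 x2 y1 y2] 3 by simp
    \<comment> \<open>The last summand contains \<open>G 0\<close>, that is \<open>x2\<close>, and
      completes the factor \<open>y2\<close> to \<open>x2 + y2\<close>.\<close>
    also have "(\<Sum>i\<le>Suc m. ?G (Suc i) * ?G (Suc m - i))
        = (\<Sum>i\<le>m. ?G (i + 1) * ?G ((m - i) + 1)) + ?G (Suc m + 1) * x2"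
      by (simp add: G_0 Suc_diff_le)
    also have "(\<Sum>i\<le>m. ?G (i + 1) * ?G ((m - i) + 1)) = (\<Sum>i\<le>m. ?M i * ?M (m - i))"
      using 3 by (intro sum.cong refl arg_cong2[where f = "(*)"] less.IH) auto
    also have "?G (Suc m + 1) = ?M (Suc m)" using 3 by (intro less.IH) simp
    finally show ?thesis
      using 3 by (simp add: motzkin_poly_Suc_Suc distrib_right mult_ac add_ac)
  qed
qed

end
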